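(* Let $m_i,m_j>0$, $e\in(0,1]$, and let $\psi:[0,\infty)\to\mathbb{R}$ be non-decreasing and satisfy: $\psi(x)\ge 0$ for $x>0$ and $\psi(0)=0$; $\psi$ is convex, $\psi\in C^1([0,\infty))$ and $\psi''$ is locally bounded; $\psi'(\alpha x)\le\eta_1(\alpha)\psi'(x)$ and $\psi''(\alpha x)\le\eta_2(\alpha)\psi''(x)$ for all $x>0$, $\alpha>1$, where $\eta_1,\eta_2$ are functions of $\alpha$ that are bounded (finite) for every $\alpha>0$. For velocities $v,v_*\in\mathbb{R}^d$ and $\sigma\in\mathbb{S}^{d-1}$, with post-collisional velocities $v',v_*'$, set $$q[\psi](v,v_*,\sigma)=\psi(m_i|v'|^2)+\psi(m_j|v_*'|^2)-\psi(m_i|v|^2)-\psi(m_j|v_*|^2).$$ Then $q[\psi]=-n[\psi]+p[\psi]$, where $$p[\psi]\le A\big(m_i|v|^2\psi'(m_j|v_*|^2)+m_j|v_*|^2\psi'(m_i|v|^2)\big)$$ and $$n[\psi]\ge\kappa(\lambda,\mu)\,\big(m_i|v|^2+m_j|v_*|^2\big)^2\,\psi''\big(m_i|v|^2+m_j|v_*|^2\big),$$ with $A=\eta_1(2)$, $b=(2\eta_2(2))^{-1}$ and $$\kappa(\lambda,\mu)=b\,\frac{m_im_j}{(m_i+m_j)^2}\,\lambda^4\,\big(\eta_2(\lambda^{-2})\big)^{-1}\sin^2\mu .$$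
   Context: Write $u=v-v_*$, $\nu=u/|u|$, $w=m_iv+m_jv_*$, $\beta=\frac{1+e}{2}$. The post-collisional velocities are $$v'=\frac{w+m_j\lambda|u|\omega}{m_i+m_j},\qquad v_*'=\frac{w-m_i\lambda|u|\omega}{m_i+m_j},$$ where $\lambda>0$ and $\omega\in\mathbb{S}^{d-1}$ are determined by $\lambda\omega=\beta\sigma+(1-\beta)\nu$. Equivalently $\lambda=(1-\beta)\cos\chi+\sqrt{(1-\beta)^2(\cos^2\chi-1)+\beta^2}$ with $\chi$ the angle between $u$ and $\omega$, and $0<e\le\lambda\le1$. The angle $\mu$ is the angle between $w$ and $\omega$ ($u$ and $w$ are taken nonzero so that the angles are defined). The quantities are $$p[\psi]=\psi(m_i|v|^2+m_j|v_*|^2)-\psi(m_i|v|^2)-\psi(m_j|v_*|^2),$$ $$n[\psi]=\psi(m_i|v|^2+m_j|v_*|^2)-\psi(m_i|v'|^2)-\psi(m_j|v_*'|^2).$$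
   Formalization: The formal theorem adds two conditions on η2, without which the bound on n[ψ] can fail: ψ''(x) ≤ η2(1)ψ''(x) for x>0 (needed when λ=1), and η2 ≤ η2(2) on all of (1,2) or on all of (2,∞). *)

theory Defs
  imports "HOL-Analysis.Analysis"
begin

definition restitution_beta :: "real \<Rightarrow> real" where
  "restitution_beta e = (1 + e) / 2"

(* \<beta> \<sigma> + (1 - \<beta>) \<nu>, where \<nu> = u / |u| = sgn u; its polar decomposition defines \<lambda> and \<omega>. *)
definition scattering_vector :: "real \<Rightarrow> 'a::euclidean_space \<Rightarrow> 'a \<Rightarrow> 'a \<Rightarrow> 'a" where
  "scattering_vector e v vs \<sigma> =
     restitution_beta e *\<^sub>R \<sigma> + (1 - restitution_beta e) *\<^sub>R sgn (v - vs)"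

definition scattering_lambda :: "real \<Rightarrow> 'a::euclidean_space \<Rightarrow> 'a \<Rightarrow> 'a \<Rightarrow> real" where
  "scattering_lambda e v vs \<sigma> = norm (scattering_vector e v vs \<sigma>)"

definition scattering_omega :: "real \<Rightarrow> 'a::euclidean_space \<Rightarrow> 'a \<Rightarrow> 'a \<Rightarrow> 'a" where
  "scattering_omega e v vs \<sigma> = sgn (scattering_vector e v vs \<sigma>)"

lemma scattering_bounds:
  fixes v vs \<sigma> :: "'a::euclidean_space"
  assumes "0 < e" "e \<le> 1" "norm \<sigma> = 1" "v \<noteq> vs"
  shows "e \<le> scattering_lambda e v vs \<sigma>" "scattering_lambda e v vs \<sigma> \<le> 1"
proof -
  let ?b = "restitution_beta e"
  have b: "0 \<le> ?b" "0 \<le> 1 - ?b" "?b - (1 - ?b) = e"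
    using assms by (auto simp: restitution_beta_def field_simps)
  have n: "norm (?b *\<^sub>R \<sigma>) = ?b" "norm ((1 - ?b) *\<^sub>R sgn (v - vs)) = 1 - ?b"
    using assms b by (simp_all add: norm_sgn)
  show "e \<le> scattering_lambda e v vs \<sigma>"
    using norm_diff_ineq[of "?b *\<^sub>R \<sigma>" "(1 - ?b) *\<^sub>R sgn (v - vs)"]
    unfolding n b(3) scattering_lambda_def scattering_vector_def .
  show "scattering_lambda e v vs \<sigma> \<le> 1"
    using norm_triangle_ineq[of "?b *\<^sub>R \<sigma>" "(1 - ?b) *\<^sub>R sgn (v - vs)"]
    unfolding n scattering_lambda_def scattering_vector_def by simp
qed

lemma scattering_determined:
  fixes v vs \<sigma> :: "'a::euclidean_space"
  assumes "0 < e" "e \<le> 1" "norm \<sigma> = 1" "v \<noteq> vs"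
  shows "(0 < l \<and> norm \<omega> = 1 \<and> l *\<^sub>R \<omega> = scattering_vector e v vs \<sigma>) \<longleftrightarrow>
         l = scattering_lambda e v vs \<sigma> \<and> \<omega> = scattering_omega e v vs \<sigma>"
proof
  assume a: "0 < l \<and> norm \<omega> = 1 \<and> l *\<^sub>R \<omega> = scattering_vector e v vs \<sigma>"
  then have "norm (scattering_vector e v vs \<sigma>) = l"
    by (metis abs_of_pos mult.right_neutral norm_scaleR)
  with a show "l = scattering_lambda e v vs \<sigma> \<and> \<omega> = scattering_omega e v vs \<sigma>"
    by (metis scattering_lambda_def scattering_omega_def sgn_div_norm sgn_scaleR sgn_pos
        scaleR_one inverse_1)
next
  assume a: "l = scattering_lambda e v vs \<sigma> \<and> \<omega> = scattering_omega e v vs \<sigma>"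
  have "0 < scattering_lambda e v vs \<sigma>"
    using scattering_bounds(1)[OF assms] assms(1) by simp
  with a show "0 < l \<and> norm \<omega> = 1 \<and> l *\<^sub>R \<omega> = scattering_vector e v vs \<sigma>"
    by (simp add: scattering_lambda_def scattering_omega_def norm_sgn sgn_div_norm)
qed

definition total_momentum :: "real \<Rightarrow> real \<Rightarrow> 'a::euclidean_space \<Rightarrow> 'a \<Rightarrow> 'a" where
  "total_momentum mi mj v vs = mi *\<^sub>R v + mj *\<^sub>R vs"

definition post_v :: "real \<Rightarrow> real \<Rightarrow> real \<Rightarrow> 'a::euclidean_space \<Rightarrow> 'a \<Rightarrow> 'a \<Rightarrow> 'a" where
  "post_v e mi mj v vs \<sigma> =
     (total_momentum mi mj v vs
        + (mj * scattering_lambda e v vs \<sigma> * norm (v - vs)) *\<^sub>R scattering_omega e v vs \<sigma>)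
     /\<^sub>R (mi + mj)"

definition post_vs :: "real \<Rightarrow> real \<Rightarrow> real \<Rightarrow> 'a::euclidean_space \<Rightarrow> 'a \<Rightarrow> 'a \<Rightarrow> 'a" where
  "post_vs e mi mj v vs \<sigma> =
     (total_momentum mi mj v vs
        - (mi * scattering_lambda e v vs \<sigma> * norm (v - vs)) *\<^sub>R scattering_omega e v vs \<sigma>)
     /\<^sub>R (mi + mj)"

(* The unoriented angle in [0, \<pi>]; meaningful for nonzero arguments only. *)
definition vec_angle :: "'a::euclidean_space \<Rightarrow> 'a \<Rightarrow> real" where
  "vec_angle x y = arccos (x \<bullet> y / (norm x * norm y))"

definition scattering_mu :: "real \<Rightarrow> real \<Rightarrow> real \<Rightarrow> 'a::euclidean_space \<Rightarrow> 'a \<Rightarrow> 'a \<Rightarrow> real" where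
  "scattering_mu e mi mj v vs \<sigma> =
     vec_angle (total_momentum mi mj v vs) (scattering_omega e v vs \<sigma>)"

definition q_fun :: "real \<Rightarrow> real \<Rightarrow> real \<Rightarrow> (real \<Rightarrow> real) \<Rightarrow>
    'a::euclidean_space \<Rightarrow> 'a \<Rightarrow> 'a \<Rightarrow> real" where
  "q_fun e mi mj \<psi> v vs \<sigma> =
     \<psi> (mi * (norm (post_v e mi mj v vs \<sigma>))\<^sup>2) + \<psi> (mj * (norm (post_vs e mi mj v vs \<sigma>))\<^sup>2)
     - \<psi> (mi * (norm v)\<^sup>2) - \<psi> (mj * (norm vs)\<^sup>2)"

definition p_fun :: "real \<Rightarrow> real \<Rightarrow> (real \<Rightarrow> real) \<Rightarrow> 'a::euclidean_space \<Rightarrow> 'a \<Rightarrow> real" where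
  "p_fun mi mj \<psi> v vs =
     \<psi> (mi * (norm v)\<^sup>2 + mj * (norm vs)\<^sup>2) - \<psi> (mi * (norm v)\<^sup>2) - \<psi> (mj * (norm vs)\<^sup>2)"

definition n_fun :: "real \<Rightarrow> real \<Rightarrow> real \<Rightarrow> (real \<Rightarrow> real) \<Rightarrow>
    'a::euclidean_space \<Rightarrow> 'a \<Rightarrow> 'a \<Rightarrow> real" where
  "n_fun e mi mj \<psi> v vs \<sigma> =
     \<psi> (mi * (norm v)\<^sup>2 + mj * (norm vs)\<^sup>2)
     - \<psi> (mi * (norm (post_v e mi mj v vs \<sigma>))\<^sup>2) - \<psi> (mj * (norm (post_vs e mi mj v vs \<sigma>))\<^sup>2)"

(* Only \<eta>2 2 and \<eta>2 (l^(-2)) enter, and l = 1 does occur (for e = 1, or for \<sigma> = \<nu>). A dilation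
   bound assumed for factors > 1 says nothing about \<eta>2 1, and \<eta>2 2 alone does not control the
   factors in (1, 2) or (2, \<infinity>); lower bounds in terms of kappa need \<eta>2 normalised accordingly. *)
definition kappa :: "real \<Rightarrow> real \<Rightarrow> (real \<Rightarrow> real) \<Rightarrow> real \<Rightarrow> real \<Rightarrow> real" where
  "kappa mi mj \<eta>2 l \<mu> =
     inverse (2 * \<eta>2 2) * (mi * mj / (mi + mj)\<^sup>2) * l ^ 4 * inverse (\<eta>2 (1 / l\<^sup>2)) * (sin \<mu>)\<^sup>2"

end

theory Submission
  imports Defs
begin

text \<open>
  Write \<open>E\<close> for the energy before the collision, \<open>X'\<close> and \<open>Y'\<close> for the energies of the two
  particles after it, and \<open>l\<close> for the length of the scattering vector; then \<open>l\<^sup>2 E \<le> X' + Y' \<le> E\<close>.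
  The gap \<open>\<psi> (x + y) - \<psi> x - \<psi> y\<close> is the integral of \<open>\<psi>''(s + t)\<close> over \<open>[0, x] \<times> [0, y]\<close>. It is
  monotone in \<open>x\<close> and \<open>y\<close>, so \<open>X'\<close> and \<open>Y'\<close> may be shrunk in proportion until their sum is
  \<open>F = l\<^sup>2 E\<close>. The line \<open>s + t = F / 2\<close> halves the rectangle, and on one of the halves
  \<open>\<psi>''(s + t) \<ge> \<psi>''(F) / \<eta>2 2\<close>. Finally \<open>\<psi>''(E) \<le> \<eta>2 (1 / l\<^sup>2) \<psi>''(F)\<close>, and
  \<open>X' Y' \<ge> mi mj / (mi + mj)\<^sup>2 \<cdot> sin\<^sup>2 \<mu> \<cdot> (X' + Y')\<^sup>2\<close> because the difference is a positive
  multiple of a perfect square.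
\<close>

section \<open>Calculus on the half-line: superadditivity gaps of convex functions\<close>

lemma convex_on_imp_deriv_mono:
  fixes f f' :: "real \<Rightarrow> real"
  assumes "convex_on A f" "connected A"
    and deriv: "\<And>x. x \<in> interior A \<Longrightarrow> (f has_real_derivative f' x) (at x)"
  shows "mono_on (interior A) f'"
proof (rule mono_onI)
  fix x y assume xy: "x \<in> interior A" "y \<in> interior A" "x \<le> y"
  have tangent: "f' s * (t - s) \<le> f t - f s" if "s \<in> interior A" "t \<in> interior A" for s t
    using convex_on_imp_above_tangent[OF assms(1,2)] that deriv[of s] interior_subset
    by (meson has_field_derivative_at_within subsetD)
  \<comment> \<open>The tangent inequality at \<open>x\<close> evaluated at \<open>y\<close>, added
    to the one at \<open>y\<close> evaluated at \<open>x\<close>.\<close>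
  have "(f' x - f' y) * (y - x) \<le> 0"
    using tangent[OF xy(1,2)] tangent[OF xy(2,1)] by (simp add: algebra_simps)
  then show "f' x \<le> f' y"
    using xy(3) by (cases "x = y") (auto simp: mult_le_0_iff)
qed

text \<open>This replaces an integration over \<open>{0..c}\<close>: the difference of the two sides
  is non-decreasing in the length of the increment. Continuity at 0 admits \<open>a = 0\<close>,
  where no derivative is given. With \<open>p = s = 0\<close> it says that increments grow with
  their base point; the affine bound is what a lower bound on the second derivative
  supplies.\<close>

lemma increment_diff_ge_quadratic:
  fixes f f' :: "real \<Rightarrow> real"
  assumes cont: "continuous_on {0..} f"
    and deriv: "\<And>x. 0 < x \<Longrightarrow> (f has_real_derivative f' x) (at x)"
    and "0 \<le> a" "0 \<le> b" "0 \<le> c"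
    and le: "\<And>z. \<lbrakk>0 < z; z < c\<rbrakk> \<Longrightarrow> p + s * z \<le> f' (b + z) - f' (a + z)"
  shows "p * c + s * c\<^sup>2 / 2 \<le> (f (b + c) - f b) - (f (a + c) - f a)"
proof -
  let ?g = "\<lambda>z. f (b + z) - f (a + z) - (p * z + s * z\<^sup>2 / 2)"
  have "?g 0 \<le> ?g c"
  proof (rule DERIV_nonneg_imp_increasing_open[OF \<open>0 \<le> c\<close>])
    fix z assume z: "0 < z" "z < c"
    have "((\<lambda>z. f (d + z)) has_real_derivative f' (d + z)) (at z)" if "0 \<le> d" for d
      using DERIV_shift[of f "f' (z + d)" z d] deriv[of "z + d"] that z by (simp add: add.commute)
    note this[OF \<open>0 \<le> a\<close>, derivative_intros] this[OF \<open>0 \<le> b\<close>, derivative_intros]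
    have "(?g has_real_derivative f' (b + z) - f' (a + z) - (p + s * z)) (at z)"
      by (auto intro!: derivative_eq_intros)
    then show "\<exists>y. (?g has_real_derivative y) (at z) \<and> 0 \<le> y"
      using le[OF z] by force
  next
    show "continuous_on {0..c} ?g"
      using assms(3-5)
      by (intro continuous_intros continuous_on_compose2[OF cont]) auto
  qed
  then show ?thesis by simp
qed

text \<open>Let \<open>y\<close> be the smaller argument, so that the midpoint
  \<open>(x + y) / 2\<close> lies between \<open>y\<close> and \<open>x\<close>. Then
  \<open>z\<close> stays below it and \<open>x + z\<close> above it for \<open>0 < z < y\<close>,
  and the part of \<open>{z..x + z}\<close> on the side without information is absorbed by
  monotonicity of \<open>f'\<close>. Either half yields the same constant.\<close>

lemma superadditivity_gap_ge:
  fixes f f' f'' :: "real \<Rightarrow> real"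
  assumes cont: "continuous_on {0..} f"
    and deriv: "\<And>x. 0 < x \<Longrightarrow> (f has_real_derivative f' x) (at x)"
    and deriv2: "\<And>x. 0 < x \<Longrightarrow> (f' has_real_derivative f'' x) (at x)"
    and mono: "mono_on {0<..} f'"
    and "0 \<le> x" "0 \<le> y"
    and ge: "(\<forall>z. (x + y) / 2 < z \<and> z < x + y \<longrightarrow> k \<le> f'' z) \<or>
             (\<forall>z. 0 < z \<and> z < (x + y) / 2 \<longrightarrow> k \<le> f'' z)"
  shows "k * x * y / 2 \<le> f (x + y) - f x - (f y - f 0)"
  using assms(5-)
proof (induction x y rule: linorder_wlog)
  case (sym x y)
  then show ?case by (simp add: algebra_simps)
next
  case (le y x)
  let ?h = "(x + y) / 2"
  have slope: "k * (t - s) \<le> f' t - f' s"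
    if "0 < s" "s \<le> t" and k: "\<And>z. \<lbrakk>s < z; z < t\<rbrakk> \<Longrightarrow> k \<le> f'' z" for s t
  proof -
    let ?g = "\<lambda>z. f' z - k * z"
    have "?g s \<le> ?g t"
    proof (rule DERIV_nonneg_imp_increasing_open[OF \<open>s \<le> t\<close>])
      fix z assume z: "s < z" "z < t"
      have "(?g has_real_derivative f'' z - k) (at z)"
        using deriv2[of z] z that by (auto intro!: derivative_eq_intros)
      with k[OF z] show "\<exists>y. (?g has_real_derivative y) (at z) \<and> 0 \<le> y"
        by force
    next
      show "continuous_on {s..t} ?g"
        using that
        by (intro continuous_intros DERIV_continuous_on[where D = f''])
          (auto intro!: has_field_derivative_at_within deriv2)
    qed
    then show ?thesis by (simp add: algebra_simps)
  qed
  have mono': "f' s \<le> f' t" if "0 < s" "s \<le> t" for s t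
    using mono_onD[OF mono] that by simp
  have gap: "p * y + s * y\<^sup>2 / 2 \<le> f (x + y) - f x - (f y - f 0)"
    if "\<And>z. \<lbrakk>0 < z; z < y\<rbrakk> \<Longrightarrow> p + s * z \<le> f' (x + z) - f' z" for p s
    using increment_diff_ge_quadratic[OF cont deriv, of 0 x y p s] that le by simp
  from le(4) have "k * x * y / 2 \<le> f (y + x) - f x - (f y - f 0)"
  proof
    assume k: "\<forall>z. (y + x) / 2 < z \<and> z < y + x \<longrightarrow> k \<le> f'' z"
    \<comment> \<open>Slope \<open>k\<close> is used from the midpoint up to \<open>x + z\<close>.
      Integrating over \<open>z\<close> gives \<open>k * y * (x - ?h + y / 2)\<close>, and the
      bracket equals \<open>x / 2\<close>.\<close>
    have "k * (x - ?h) + k * z \<le> f' (x + z) - f' z" if "0 < z" "z < y" for z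
      using slope[of ?h "x + z"] mono'[of z ?h] k that le by (simp add: algebra_simps)
    from gap[OF this] show ?thesis
      by (simp add: field_simps power2_eq_square)
  next
    assume k: "\<forall>z. 0 < z \<and> z < (y + x) / 2 \<longrightarrow> k \<le> f'' z"
    \<comment> \<open>Slope \<open>k\<close> is used from \<open>z\<close> up to the midpoint. The
      integral is \<open>k * y * (?h - y / 2)\<close>, again with bracket
      \<open>x / 2\<close>.\<close>
    have "k * ?h + - k * z \<le> f' (x + z) - f' z" if "0 < z" "z < y" for z
      using slope[of z ?h] mono'[of ?h "x + z"] k that le by (simp add: algebra_simps)
    from gap[OF this] show ?thesis
      by (simp add: field_simps power2_eq_square)
  qed
  then show ?case by (simp add: algebra_simps)
qed

lemma superadditivity_gap_ge_scaled:
  fixes f f' f'' :: "real \<Rightarrow> real"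
  assumes cont: "continuous_on {0..} f"
    and deriv: "\<And>x. 0 < x \<Longrightarrow> (f has_real_derivative f' x) (at x)"
    and deriv2: "\<And>x. 0 < x \<Longrightarrow> (f' has_real_derivative f'' x) (at x)"
    and mono: "mono_on {0<..} f'"
    and "0 \<le> x" "0 \<le> y" "0 < F" "F \<le> x + y"
    and ge: "(\<forall>z. F / 2 < z \<and> z < F \<longrightarrow> k \<le> f'' z) \<or> (\<forall>z. 0 < z \<and> z < F / 2 \<longrightarrow> k \<le> f'' z)"
  shows "k / 2 * (x * y * (F / (x + y))\<^sup>2) \<le> f (x + y) - f x - (f y - f 0)"
proof -
  define q where "q = F / (x + y)"
  have q: "0 < q" "q \<le> 1" "q * (x + y) = F"
    using assms(7,8) by (auto simp: q_def)
  have qx: "0 \<le> q * x" "q * x \<le> x" and qy: "0 \<le> q * y" "q * y \<le> y"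
    using q(1,2) assms(5,6) by (auto intro: mult_left_le_one_le)
  have mono_gap: "f (a + c) - f a \<le> f (b + c) - f b" if "0 \<le> a" "a \<le> b" "0 \<le> c" for a b c
    using increment_diff_ge_quadratic[OF cont deriv, of a b c 0 0] mono_onD[OF mono] that by simp
  have sum: "q * x + q * y = F"
    using q(3) by (simp add: distrib_left)
  have "k * (q * x) * (q * y) / 2 \<le> f (q * x + q * y) - f (q * x) - (f (q * y) - f 0)"
    using ge by (intro superadditivity_gap_ge[OF cont deriv deriv2 mono qx(1) qy(1)]) (simp_all add: sum)
  also have "\<dots> \<le> f (x + q * y) - f x - (f (q * y) - f 0)"
    using mono_gap[OF qx qy(1)] by simp
  also have "\<dots> \<le> f (x + y) - f x - (f y - f 0)"
    using mono_gap[OF qy assms(5)] by (simp add: add.commute)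
  finally show ?thesis
    by (simp add: q_def[symmetric] power2_eq_square mult_ac)
qed

lemma superadditivity_gap_le_doubling:
  fixes f f' :: "real \<Rightarrow> real"
  assumes deriv: "\<And>x. 0 < x \<Longrightarrow> (f has_real_derivative f' x) (at x)"
    and cont: "continuous_on {0..} f'"
    and mono: "mono_on {0<..} f'"
    and nonneg: "\<And>x. 0 < x \<Longrightarrow> 0 \<le> f' x"
    and doubling: "\<And>x. 0 < x \<Longrightarrow> f' (2 * x) \<le> A * f' x"
    and f: "f 0 = 0" "\<And>x. 0 < x \<Longrightarrow> 0 \<le> f x"
    and "0 \<le> x" "0 \<le> y"
  shows "f (x + y) - f x - f y \<le> A * (x * f' y + y * f' x)"
  using assms(8-)
proof (induction x y rule: linorder_wlog)
  case (sym x y)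
  then show ?case by (simp add: algebra_simps)
next
  case (le y x)
  have lim: "(f' \<longlongrightarrow> f' 0) (at_right 0)"
    using cont by (auto simp: continuous_on_def intro: tendsto_within_subset)
  have zero: "f' 0 \<ge> 0"
    by (rule tendsto_lowerbound[OF lim eventually_mono[OF eventually_at_right_less nonneg]]) auto
  \<comment> \<open>No sign of \<open>A\<close> is assumed. A negative \<open>A\<close> forces
    \<open>f'\<close> to vanish on the positive axis, hence by continuity also at 0, which is the
    value that enters when \<open>y = 0\<close>.\<close>
  have Af: "0 \<le> A * f' s" if "0 \<le> s" for s
  proof (cases "0 \<le> A")
    case True
    then show ?thesis using nonneg[of s] zero that by (cases "s = 0") auto
  next
    case False
    have "f' t = 0" if "0 < t" for t
      using doubling[OF that] nonneg[of "2 * t"] nonneg[OF that] that False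
      by (smt (verit) mult_neg_pos)
    then have "(f' \<longlongrightarrow> 0) (at_right 0)"
      by (intro tendsto_eventually eventually_mono[OF eventually_at_right_less]) auto
    then have "f' 0 = 0"
      using tendsto_unique[OF _ lim] by simp
    with \<open>\<And>t. 0 < t \<Longrightarrow> f' t = 0\<close> show ?thesis using that by (cases "s = 0") auto
  qed
  have fy: "0 \<le> f y"
    using f le by (cases "y = 0") auto
  \<comment> \<open>As \<open>y\<close> is the smaller argument, the mean value point lies below
    \<open>2 * x\<close>, where the doubling bound applies.\<close>
  have *: "f (x + y) - f x \<le> A * (y * f' x)"
  proof (cases "y = 0")
    case False
    with le have "0 < y" "0 < x" by auto
    then obtain z where z: "x < z" "z < x + y" "f (x + y) - f x = (x + y - x) * f' z"
      using MVT2[of x "x + y" f f'] deriv by auto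
    have "f' z \<le> f' (2 * x)"
      using mono_onD[OF mono, of z "2 * x"] z le \<open>0 < x\<close> by simp
    also have "\<dots> \<le> A * f' x" using doubling[OF \<open>0 < x\<close>] .
    finally have "y * f' z \<le> y * (A * f' x)" using le by (intro mult_left_mono) auto
    then show ?thesis using z(3) by (simp add: mult_ac)
  qed simp
  have "0 \<le> A * (x * f' y)"
    using mult_nonneg_nonneg[OF le(3) Af[OF le(2)]] by (simp add: mult_ac)
  with * fy show ?case by (simp add: algebra_simps)
qed

section \<open>Angles and the energy balance of a collision\<close>

lemma sin_vec_angle_squared:
  "(sin (vec_angle x y))\<^sup>2 = 1 - (x \<bullet> y / (norm x * norm y))\<^sup>2"
proof -
  \<comment> \<open>If a vector is zero, the quotient is 0 by the convention for division, and both
    sides of the claim are 1.\<close>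
  have "\<bar>x \<bullet> y / (norm x * norm y)\<bar> \<le> 1"
    using Cauchy_Schwarz_ineq2[of x y] by (simp add: divide_le_eq)
  then have "cos (vec_angle x y) = x \<bullet> y / (norm x * norm y)"
    by (simp add: vec_angle_def cos_arccos_abs)
  then show ?thesis
    using sin_squared_eq[of "vec_angle x y"] by simp
qed

lemma norm_add_scaleR_squared:
  fixes w n :: "'a::real_inner"
  assumes "norm n = 1"
  shows "(norm (w + t *\<^sub>R n))\<^sup>2 = (norm w)\<^sup>2 + t\<^sup>2 + 2 * t * (w \<bullet> n)"
  using assms unfolding power2_norm_eq_inner
  by (simp add: norm_eq_1 inner_add_left inner_add_right inner_commute power2_eq_square)

lemma norm_post_v_squared:
  assumes "norm (scattering_omega e v vs \<sigma>) = 1"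
    and "w = total_momentum mi mj v vs" "r = scattering_lambda e v vs \<sigma> * norm (v - vs)"
  shows "(norm (post_v e mi mj v vs \<sigma>))\<^sup>2 =
    ((norm w)\<^sup>2 + (mj * r)\<^sup>2 + 2 * (mj * r) * (w \<bullet> scattering_omega e v vs \<sigma>)) / (mi + mj)\<^sup>2"
  using norm_add_scaleR_squared[OF assms(1), of w "mj * r"]
  by (simp add: post_v_def assms(2,3) power_mult_distrib divide_inverse power_inverse mult.assoc)

lemma norm_post_vs_squared:
  assumes "norm (scattering_omega e v vs \<sigma>) = 1"
    and "w = total_momentum mi mj v vs" "r = scattering_lambda e v vs \<sigma> * norm (v - vs)"
  shows "(norm (post_vs e mi mj v vs \<sigma>))\<^sup>2 =
    ((norm w)\<^sup>2 + (mi * r)\<^sup>2 - 2 * (mi * r) * (w \<bullet> scattering_omega e v vs \<sigma>)) / (mi + mj)\<^sup>2"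
  using norm_add_scaleR_squared[OF assms(1), of w "- (mi * r)"]
  by (simp add: post_vs_def assms(2,3) power_mult_distrib divide_inverse power_inverse mult.assoc)

text \<open>The split into centre-of-mass and relative energy; the cross terms in
  \<open>v \<bullet> vs\<close> cancel.\<close>

lemma kinetic_energy_decomposition:
  "(mi + mj) * (mi * (norm v)\<^sup>2 + mj * (norm vs)\<^sup>2) =
    (norm (total_momentum mi mj v vs))\<^sup>2 + mi * mj * (norm (v - vs))\<^sup>2"
  unfolding power2_norm_eq_inner total_momentum_def
  by (simp add: inner_add_left inner_add_right inner_diff_left inner_diff_right inner_commute
      algebra_simps)

text \<open>Weighting by the masses cancels the terms in \<open>d\<close>, so the total does not see
  the scattering direction. The form is that of \<open>kinetic_energy_decomposition\<close> with
  \<open>r\<close> as relative speed: a collision changes only the relative part.\<close>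

lemma post_energy:
  fixes mi mj W r d :: real
  assumes "0 < mi" "0 < mj"
  defines "X \<equiv> mi * ((W\<^sup>2 + (mj * r)\<^sup>2 + 2 * (mj * r) * d) / (mi + mj)\<^sup>2)"
    and "Y \<equiv> mj * ((W\<^sup>2 + (mi * r)\<^sup>2 - 2 * (mi * r) * d) / (mi + mj)\<^sup>2)"
  shows "(mi + mj) * (X + Y) = W\<^sup>2 + mi * mj * r\<^sup>2"
proof -
  have XY: "(mi + mj)\<^sup>2 * X = mi * (W\<^sup>2 + (mj * r)\<^sup>2 + 2 * (mj * r) * d)"
    "(mi + mj)\<^sup>2 * Y = mj * (W\<^sup>2 + (mi * r)\<^sup>2 - 2 * (mi * r) * d)"
    using assms(1,2) unfolding X_def Y_def by simp_all
  have "(mi + mj)\<^sup>2 * (X + Y) = mi * (W\<^sup>2 + (mj * r)\<^sup>2 + 2 * (mj * r) * d)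
      + mj * (W\<^sup>2 + (mi * r)\<^sup>2 - 2 * (mi * r) * d)"
    unfolding distrib_left[of _ X Y] XY ..
  also have "\<dots> = (mi + mj) * (W\<^sup>2 + mi * mj * r\<^sup>2)"
    by (simp add: algebra_simps power2_eq_square)
  finally have "(mi + mj)\<^sup>2 * (X + Y) = (mi + mj) * (W\<^sup>2 + mi * mj * r\<^sup>2)" .
  then show ?thesis
    using assms(1,2) by (simp add: power2_eq_square)
qed

text \<open>Up to a positive factor the difference is a quadratic in \<open>c\<close> with leading
  coefficient the square of \<open>W\<^sup>2 - mi * mj * r\<^sup>2\<close>, constant term the square
  of \<open>(mj - mi) * r * W\<close>, and middle term twice the product of these roots.\<close>

lemma post_energy_product_ge:
  fixes mi mj W r c :: real
  assumes "0 < mi" "0 < mj"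
  defines "X \<equiv> mi * ((W\<^sup>2 + (mj * r)\<^sup>2 + 2 * (mj * r) * (W * c)) / (mi + mj)\<^sup>2)"
    and "Y \<equiv> mj * ((W\<^sup>2 + (mi * r)\<^sup>2 - 2 * (mi * r) * (W * c)) / (mi + mj)\<^sup>2)"
  shows "mi * mj / (mi + mj)\<^sup>2 * (1 - c\<^sup>2) * (X + Y)\<^sup>2 \<le> X * Y"
proof -
  let ?M = "mi + mj"
  have M: "0 < ?M" using assms(1,2) by simp
  have E: "X + Y = (W\<^sup>2 + mi * mj * r\<^sup>2) / ?M"
    using post_energy[OF assms(1,2), of W r "W * c"] M unfolding X_def Y_def
    by (simp add: eq_divide_eq mult.commute)
  have *: "mi * (a / ?M\<^sup>2) * (mj * (b / ?M\<^sup>2)) - mi * mj / ?M\<^sup>2 * k * (t / ?M)\<^sup>2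
      = mi * mj * (a * b - k * t\<^sup>2) / ?M ^ 4" for a b k t
    by (simp add: power_divide diff_divide_distrib right_diff_distrib power_add[of ?M 2 2, simplified] mult_ac)
  have "X * Y - mi * mj / ?M\<^sup>2 * (1 - c\<^sup>2) * (X + Y)\<^sup>2
      = mi * mj * ((W\<^sup>2 + (mj * r)\<^sup>2 + 2 * (mj * r) * (W * c)) *
          (W\<^sup>2 + (mi * r)\<^sup>2 - 2 * (mi * r) * (W * c))
        - (1 - c\<^sup>2) * (W\<^sup>2 + mi * mj * r\<^sup>2)\<^sup>2) / ?M ^ 4"
    unfolding E unfolding X_def Y_def by (rule *)
  also have "\<dots> = mi * mj * ((W\<^sup>2 - mi * mj * r\<^sup>2) * c + (mj - mi) * r * W)\<^sup>2 / ?M ^ 4"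
    by (rule arg_cong[where f = "\<lambda>t. mi * mj * t / ?M ^ 4"])
      (simp add: algebra_simps eval_nat_numeral)
  finally show ?thesis
    using assms(1,2) by (smt (verit) divide_nonneg_nonneg mult_nonneg_nonneg zero_le_power2 zero_le_power)
qed

section \<open>The estimates for the collision functional\<close>

theorem lemma4p2:
  fixes mi mj e :: real
    and \<psi> \<psi>' \<psi>'' \<eta>1 \<eta>2 :: "real \<Rightarrow> real"
    and v vs \<sigma> :: "'a::euclidean_space"
  assumes masses: "0 < mi" "0 < mj"
    and restitution: "0 < e" "e \<le> 1"
    and psi_mono: "mono_on {0..} \<psi>"
    and psi_nonneg: "\<forall>x>0. 0 \<le> \<psi> x"
    and psi_zero: "\<psi> 0 = 0"
    and psi_convex: "convex_on {0..} \<psi>"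
    and psi_deriv: "\<forall>x\<ge>0. (\<psi> has_real_derivative \<psi>' x) (at x within {0..})"
    and psi_C1: "continuous_on {0..} \<psi>'"
    and psi_deriv2: "\<forall>x>0. (\<psi>' has_real_derivative \<psi>'' x) (at x)"
    and psi_deriv2_loc_bdd: "\<forall>K. compact K \<and> K \<subseteq> {0<..} \<longrightarrow> bounded (\<psi>'' ` K)"
    and eta1: "\<forall>x>0. \<forall>\<alpha>>1. \<psi>' (\<alpha> * x) \<le> \<eta>1 \<alpha> * \<psi>' x"
    and eta2: "\<forall>x>0. \<forall>\<alpha>>1. \<psi>'' (\<alpha> * x) \<le> \<eta>2 \<alpha> * \<psi>'' x"
    and eta2_at_one: "\<forall>x>0. \<psi>'' x \<le> \<eta>2 1 * \<psi>'' x"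
    and eta2_at_two: "(\<forall>\<alpha>. 1 < \<alpha> \<and> \<alpha> < 2 \<longrightarrow> \<eta>2 \<alpha> \<le> \<eta>2 2) \<or> (\<forall>\<alpha>>2. \<eta>2 \<alpha> \<le> \<eta>2 2)"
    and sigma: "\<sigma> \<in> sphere 0 1"
    and u_nonzero: "v - vs \<noteq> 0"
    and w_nonzero: "total_momentum mi mj v vs \<noteq> 0"
  shows "q_fun e mi mj \<psi> v vs \<sigma> = - n_fun e mi mj \<psi> v vs \<sigma> + p_fun mi mj \<psi> v vs
    \<and> p_fun mi mj \<psi> v vs
        \<le> \<eta>1 2 * (mi * (norm v)\<^sup>2 * \<psi>' (mj * (norm vs)\<^sup>2) + mj * (norm vs)\<^sup>2 * \<psi>' (mi * (norm v)\<^sup>2))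
    \<and> n_fun e mi mj \<psi> v vs \<sigma>
        \<ge> kappa mi mj \<eta>2 (scattering_lambda e v vs \<sigma>) (scattering_mu e mi mj v vs \<sigma>)
           * (mi * (norm v)\<^sup>2 + mj * (norm vs)\<^sup>2)\<^sup>2 * \<psi>'' (mi * (norm v)\<^sup>2 + mj * (norm vs)\<^sup>2)"
proof -
  have interior: "interior {0::real..} = {0<..}"
    by (simp add: interior_real_atLeast)
  have deriv: "(\<psi> has_real_derivative \<psi>' x) (at x)" if "0 < x" for x
    using psi_deriv that at_within_interior[of x "{0..}"] interior
    by (metis greaterThan_iff less_imp_le)
  have deriv2: "(\<psi>' has_real_derivative \<psi>'' x) (at x)" if "0 < x" for x
    using psi_deriv2 that by blast
  have cont: "continuous_on {0..} \<psi>"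
    using psi_deriv by (meson DERIV_continuous atLeast_iff continuous_on_eq_continuous_within)
  have mono: "mono_on {0<..} \<psi>'"
    using convex_on_imp_deriv_mono[OF psi_convex] deriv interior by auto
  have nonneg: "0 \<le> \<psi>' x" if "0 < x" for x
    using mono_on_imp_deriv_nonneg[OF psi_mono deriv] that interior by auto
  have nonneg2: "0 \<le> \<psi>'' x" if "0 < x" for x
    using mono_on_imp_deriv_nonneg[OF mono deriv2] that by (auto simp: interior_open)

  define X where "X = mi * (norm v)\<^sup>2"
  define Y where "Y = mj * (norm vs)\<^sup>2"
  define X' where "X' = mi * (norm (post_v e mi mj v vs \<sigma>))\<^sup>2"
  define Y' where "Y' = mj * (norm (post_vs e mi mj v vs \<sigma>))\<^sup>2"
  define l where "l = scattering_lambda e v vs \<sigma>"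
  define s where "s = sin (scattering_mu e mi mj v vs \<sigma>)"
  define \<omega> where "\<omega> = scattering_omega e v vs \<sigma>"
  define w where "w = total_momentum mi mj v vs"
  \<comment> \<open>The energy at which \<open>\<psi>''\<close> is compared with its value at
    \<open>X + Y\<close>: the dilation factor between them is exactly the
    \<open>1 / l\<^sup>2\<close> of \<open>kappa\<close>.\<close>
  define F where "F = l\<^sup>2 * (X + Y)"
  define m where "m = mi * mj / (mi + mj)\<^sup>2"
  have nonneg_energy: "0 \<le> X" "0 \<le> Y" "0 \<le> X'" "0 \<le> Y'"
    using masses by (auto simp: X_def Y_def X'_def Y'_def)
  have M: "0 < mi + mj" using masses by simp
  have "v \<noteq> vs" "norm \<sigma> = 1" using u_nonzero sigma by auto
  note scat = scattering_bounds[OF restitution this(2,1)]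
  have l: "0 < l" "l \<le> 1" using scat restitution by (auto simp: l_def)
  have \<omega>: "norm \<omega> = 1"
    using l(1) by (auto simp: \<omega>_def l_def scattering_lambda_def scattering_omega_def norm_sgn)
  define c where "c = w \<bullet> \<omega> / norm w"
  have w: "norm w \<noteq> 0" "w \<bullet> \<omega> = norm w * c"
    using w_nonzero by (auto simp: w_def c_def)
  have s: "s\<^sup>2 = 1 - c\<^sup>2"
    using sin_vec_angle_squared[of w \<omega>] \<omega>
    by (simp add: s_def c_def scattering_mu_def w_def \<omega>_def)
  define r where "r = l * norm (v - vs)"
  have X': "X' = mi * (((norm w)\<^sup>2 + (mj * r)\<^sup>2 + 2 * (mj * r) * (norm w * c)) / (mi + mj)\<^sup>2)"
    using norm_post_v_squared[OF \<omega>[unfolded \<omega>_def] w_def r_def[unfolded l_def]] w(2)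
    by (simp add: X'_def \<omega>_def)
  have Y': "Y' = mj * (((norm w)\<^sup>2 + (mi * r)\<^sup>2 - 2 * (mi * r) * (norm w * c)) / (mi + mj)\<^sup>2)"
    using norm_post_vs_squared[OF \<omega>[unfolded \<omega>_def] w_def r_def[unfolded l_def]] w(2)
    by (simp add: Y'_def \<omega>_def)
  have product: "m * s\<^sup>2 * (X' + Y')\<^sup>2 \<le> X' * Y'"
    unfolding m_def s X' Y' by (rule post_energy_product_ge[OF masses])
  have pre: "(mi + mj) * (X + Y) = (norm w)\<^sup>2 + mi * mj * (norm (v - vs))\<^sup>2"
    unfolding X_def Y_def w_def by (rule kinetic_energy_decomposition)
  have post: "(mi + mj) * (X' + Y') = (norm w)\<^sup>2 + mi * mj * (l\<^sup>2 * (norm (v - vs))\<^sup>2)"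
    using post_energy[OF masses, of "norm w" r "norm w * c"]
    by (simp add: X' Y') (simp add: r_def power_mult_distrib)
  have l2: "l\<^sup>2 \<le> 1" using l by (simp add: power_le_one)
  have "0 < (mi + mj) * (X + Y)"
    unfolding pre using w masses by (intro add_pos_nonneg) auto
  then have E: "0 < X + Y" using M by (simp add: zero_less_mult_iff)
  have "(mi + mj) * (X' + Y') \<le> (mi + mj) * (X + Y)"
    unfolding pre post using l2 masses by (intro add_left_mono mult_left_mono mult_left_le_one_le) auto
  then have loss: "X' + Y' \<le> X + Y" using M by simp
  \<comment> \<open>Multiplying by \<open>l\<^sup>2\<close> shrinks both parts of the energy,
    whereas the collision shrinks only the relative one.\<close>
  have "(mi + mj) * F = l\<^sup>2 * (norm w)\<^sup>2 + mi * mj * (l\<^sup>2 * (norm (v - vs))\<^sup>2)"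
    using arg_cong[OF pre, of "(*) (l\<^sup>2)"] by (simp add: F_def algebra_simps)
  also have "\<dots> \<le> (mi + mj) * (X' + Y')"
    unfolding post using l2 by (intro add_right_mono mult_left_le_one_le) auto
  finally have F: "0 < F" "F \<le> X' + Y'"
    using M E l by (auto simp: F_def)
  \<comment> \<open>The energy loss only helps, since \<open>\<psi>\<close> is non-decreasing and
    \<open>X' + Y' \<le> X + Y\<close>.\<close>
  have gap: "k / 2 * (X' * Y' * (F / (X' + Y'))\<^sup>2) \<le> \<psi> (X + Y) - \<psi> X' - \<psi> Y'"
    if "(\<forall>z. F / 2 < z \<and> z < F \<longrightarrow> k \<le> \<psi>'' z) \<or> (\<forall>z. 0 < z \<and> z < F / 2 \<longrightarrow> k \<le> \<psi>'' z)" for k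
    using superadditivity_gap_ge_scaled[OF cont deriv deriv2 mono nonneg_energy(3,4) F that]
      mono_onD[OF psi_mono, of "X' + Y'" "X + Y"] loss nonneg_energy psi_zero by simp

  have n_bound: "kappa mi mj \<eta>2 l (scattering_mu e mi mj v vs \<sigma>) * (X + Y)\<^sup>2 * \<psi>'' (X + Y)
      \<le> \<psi> (X + Y) - \<psi> X' - \<psi> Y'"
  \<comment> \<open>The values of \<open>\<eta>2\<close> have no prescribed sign. If
    \<open>\<psi>''\<close> vanishes at \<open>X + Y\<close>, so does the lower bound, whatever
    \<open>kappa\<close> is; otherwise the dilation inequalities force \<open>h\<close> and
    \<open>\<eta>2 2\<close> to be positive.\<close>
  proof (cases "\<psi>'' (X + Y) = 0")
    case True
    then show ?thesis using gap[of 0] nonneg2 F(1) by simp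
  next
    case False
    then have pos: "0 < \<psi>'' (X + Y)" using nonneg2[OF E] by simp
    define h where "h = \<eta>2 (1 / l\<^sup>2)"
    have E_eq: "X + Y = 1 / l\<^sup>2 * F" using l by (simp add: F_def)
    have h: "\<psi>'' (X + Y) \<le> h * \<psi>'' F"
    proof (cases "l = 1")
      case True
      then show ?thesis using eta2_at_one F(1) by (simp add: h_def F_def)
    next
      case False
      then have "1 < 1 / l\<^sup>2" using l by (simp add: power_less_one_iff)
      then show ?thesis unfolding E_eq h_def using eta2 F(1) by blast
    qed
    have "0 < h" "0 < \<psi>'' F"
      using pos h nonneg2[OF F(1)] by (smt (verit) mult_nonneg_nonneg mult_nonpos_nonneg mult_not_zero)+
    have "\<psi>'' (X + Y) \<le> \<eta>2 2 * \<psi>'' ((X + Y) / 2)"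
      using eta2[rule_format, of "(X + Y) / 2" 2] E by (simp add: add_divide_distrib)
    then have eta_pos: "0 < \<eta>2 2"
      using pos mult_nonpos_nonneg[OF _ nonneg2[OF half_gt_zero[OF E]], of "\<eta>2 2"]
      by (meson less_le_trans not_less)
    \<comment> \<open>For \<open>z\<close> in the upper half of \<open>(0, F)\<close> the factor
      \<open>F / z\<close> lies strictly between 1 and 2, in the lower half it exceeds 2. So each
      alternative in \<open>eta2_at_two\<close> makes \<open>k\<close> a lower bound for
      \<open>\<psi>''\<close> on one half.\<close>
    define k where "k = \<psi>'' F / \<eta>2 2"
    have k: "k \<le> \<psi>'' z" if "0 < z" "z < F" "\<eta>2 (F / z) \<le> \<eta>2 2" for z
    proof -
      have "\<psi>'' F \<le> \<eta>2 (F / z) * \<psi>'' z"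
        using eta2[rule_format, of z "F / z"] that by simp
      also have "\<dots> \<le> \<eta>2 2 * \<psi>'' z"
        using that nonneg2 by (intro mult_right_mono) auto
      finally show ?thesis using eta_pos by (simp add: k_def divide_le_eq mult.commute)
    qed
    \<comment> \<open>The source of the fourth power in \<open>kappa\<close>.\<close>
    have F2: "F\<^sup>2 = l ^ 4 * (X + Y)\<^sup>2"
      by (simp add: F_def power_mult_distrib)
    have "kappa mi mj \<eta>2 l (scattering_mu e mi mj v vs \<sigma>) * (X + Y)\<^sup>2 * \<psi>'' (X + Y)
        = m * s\<^sup>2 * F\<^sup>2 / (2 * \<eta>2 2) * (\<psi>'' (X + Y) / h)"
      unfolding kappa_def F2 m_def[symmetric] s_def[symmetric] h_def[symmetric]
      by (simp add: inverse_eq_divide mult_ac)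
    also have "\<dots> \<le> m * s\<^sup>2 * F\<^sup>2 / (2 * \<eta>2 2) * \<psi>'' F"
      using h \<open>0 < h\<close> eta_pos masses
      by (intro mult_left_mono) (auto simp: m_def divide_le_eq mult.commute)
    \<comment> \<open>Writing \<open>F\<close> as \<open>(X' + Y') * (F / (X' + Y'))\<close> exposes
      the square in \<open>product\<close>.\<close>
    also have "\<dots> = k / 2 * (m * s\<^sup>2 * (X' + Y')\<^sup>2 * (F / (X' + Y'))\<^sup>2)"
      using F by (simp add: k_def power_divide mult_ac)
    also have "\<dots> \<le> k / 2 * (X' * Y' * (F / (X' + Y'))\<^sup>2)"
      using product eta_pos \<open>0 < \<psi>'' F\<close> by (intro mult_left_mono mult_right_mono) (auto simp: k_def)
    also have "\<dots> \<le> \<psi> (X + Y) - \<psi> X' - \<psi> Y'"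
    proof (rule gap)
      from eta2_at_two
      show "(\<forall>z. F / 2 < z \<and> z < F \<longrightarrow> k \<le> \<psi>'' z) \<or> (\<forall>z. 0 < z \<and> z < F / 2 \<longrightarrow> k \<le> \<psi>'' z)"
      proof
        assume "\<forall>\<alpha>. 1 < \<alpha> \<and> \<alpha> < 2 \<longrightarrow> \<eta>2 \<alpha> \<le> \<eta>2 2"
        then have "k \<le> \<psi>'' z" if "F / 2 < z" "z < F" for z
          using that F(1) by (intro k) (auto simp: field_simps)
        then show ?thesis by blast
      next
        assume "\<forall>\<alpha>>2. \<eta>2 \<alpha> \<le> \<eta>2 2"
        then have "k \<le> \<psi>'' z" if "0 < z" "z < F / 2" for z
          using that F(1) by (intro k) (auto simp: field_simps)
        then show ?thesis by blast
      qed
    qed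
    finally show ?thesis .
  qed
  have "\<psi> (X + Y) - \<psi> X - \<psi> Y \<le> \<eta>1 2 * (X * \<psi>' Y + Y * \<psi>' X)"
    using eta1 psi_nonneg nonneg_energy
    by (intro superadditivity_gap_le_doubling[OF deriv psi_C1 mono nonneg _ psi_zero]) auto
  with n_bound show ?thesis
    unfolding q_fun_def n_fun_def p_fun_def X_def[symmetric] Y_def[symmetric] X'_def[symmetric]
      Y'_def[symmetric] l_def[symmetric] by linarith
qed

end
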